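(* Let $N\ge 2$, let $\mathcal H$ be an $N$-dimensional complex Hilbert space with fixed orthonormal basis $\{|\mu\rangle\}_{\mu=0}^{N-1}$, and let $\alpha\in\mathbb R$ with $0<|1+\alpha|<1$ be such that $$\Lambda(\rho)=\sum_{\mu=0}^{N-1}\rho_{\mu\mu}|\mu\rangle\langle\mu|+(1+\alpha)\sum_{\mu\neq\nu}\rho_{\mu\nu}|\mu\rangle\langle\nu|$$ is completely positive and trace-preserving. Let $0<\eta<1$, let $\Psi_N$ be a maximally coherent state, and let $r$ be the depth of the network on $\Psi_N$ with precision $\eta$, i.e. the minimum number of applications $r$ such that $C_{l_1}(\Lambda^r(\Psi_N))\le\eta$. Then $$r\ \ge\ \left\lceil\frac{\log(\eta)-\log(N-1)}{\log\big(N-1-D_{C_{l_1}}(\Lambda)\big)-\log(N-1)}\right\rceil ,$$ where $D_{C_{l_1}}(\Lambda)$ is the $l_1$-decohering power of $\Lambda$.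
   Context: $\rho_{\mu\nu}=\langle\mu|\rho|\nu\rangle$; $\Lambda^r$ is the $r$-fold composition of $\Lambda$. The $l_1$-coherence measure is $C_{l_1}(\rho)=\sum_{\mu\ne\nu}|\rho_{\mu\nu}|$. The set of maximally coherent states is $S_{\mathrm{MCS}}=\{\frac1{\sqrt N}\sum_{j=0}^{N-1}e^{i\theta_j}|j\rangle : \theta_j\in[0,2\pi)\}$; for a vector $|\Psi\rangle$ write $\Psi=|\Psi\rangle\langle\Psi|$. The $l_1$-decohering power is $D_{C_{l_1}}(\mathcal E)=\max_{\Psi_N\in S_{\mathrm{MCS}}}\big(C_{l_1}(\Psi_N)-C_{l_1}(\mathcal E(\Psi_N))\big)$. *)

theory Defs
  imports "HOL-Analysis.Analysis"
begin

text \<open>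
  The \<open>N\<close>-dimensional Hilbert space with its fixed orthonormal basis is \<open>complex^'n\<close> with
  \<open>N = CARD('n)\<close>; the basis is indexed by \<open>'n\<close> instead of \<open>0, \<dots>, N - 1\<close>. Operators are matrices
  with respect to this basis, so that \<open>\<rho> $ \<mu> $ \<nu>\<close> is the matrix element \<open>\<langle>\<mu>|\<rho>|\<nu>\<rangle>\<close>.
\<close>

definition ket :: "'n::finite \<Rightarrow> complex^'n" where
  "ket \<mu> = axis \<mu> 1"

definition ketbra :: "complex^'n \<Rightarrow> complex^'n \<Rightarrow> complex^'n^'n" where
  "ketbra v w = (\<chi> i j. v $ i * cnj (w $ j))"

definition matrix_scale :: "complex \<Rightarrow> complex^'n^'n \<Rightarrow> complex^'n^'n"  (infixl "*\<^sub>C" 70) where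
  "c *\<^sub>C A = (\<chi> i j. c * A $ i $ j)"

abbreviation pure_state :: "complex^'n \<Rightarrow> complex^'n^'n" where
  "pure_state v \<equiv> ketbra v v"

text \<open>The sesquilinear inner product; \<^const>\<open>inner\<close> on this type is only its real part.\<close>

definition braket :: "complex^'n \<Rightarrow> complex^'n \<Rightarrow> complex" where
  "braket v w = (\<Sum>i\<in>UNIV. cnj (v $ i) * w $ i)"

text \<open>
  An operator on \<open>\<complex>\<^sup>k \<otimes> \<complex>\<^sup>N\<close> is represented by its \<open>k \<times> k\<close> array of blocks \<open>X i j\<close> and a vector
  by its \<open>k\<close> components \<open>v i\<close>. The extension \<open>id\<^sub>k \<otimes> E\<close> applies \<open>E\<close> to each block.
\<close>

definition block_positive :: "nat \<Rightarrow> (nat \<Rightarrow> nat \<Rightarrow> complex^'n^'n) \<Rightarrow> bool" where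
  "block_positive k X \<longleftrightarrow>
     (\<forall>v :: nat \<Rightarrow> complex^'n. (\<Sum>i<k. \<Sum>j<k. braket (v i) (X i j *v v j)) \<in> \<real>\<^sub>\<ge>\<^sub>0)"

definition complex_linear_map :: "(complex^'n^'n \<Rightarrow> complex^'n^'n) \<Rightarrow> bool" where
  "complex_linear_map E \<longleftrightarrow>
     (\<forall>A B. E (A + B) = E A + E B) \<and> (\<forall>c A. E (c *\<^sub>C A) = c *\<^sub>C E A)"

definition completely_positive :: "(complex^'n^'n \<Rightarrow> complex^'n^'n) \<Rightarrow> bool" where
  "completely_positive E \<longleftrightarrow> complex_linear_map E \<and>
     (\<forall>k X. block_positive k X \<longrightarrow> block_positive k (\<lambda>i j. E (X i j)))"

definition trace_preserving :: "(complex^'n^'n \<Rightarrow> complex^'n^'n) \<Rightarrow> bool" where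
  "trace_preserving E \<longleftrightarrow> (\<forall>A. trace (E A) = trace A)"

definition C_l1 :: "complex^'n^'n \<Rightarrow> real" where
  "C_l1 \<rho> = (\<Sum>\<mu>\<in>UNIV. \<Sum>\<nu>\<in>UNIV - {\<mu>}. norm (\<rho> $ \<mu> $ \<nu>))"

definition max_coherent_states :: "(complex^'n) set" where
  "max_coherent_states =
     {complex_of_real (1 / sqrt (real CARD('n))) *s
        (\<Sum>j\<in>UNIV. exp (\<i> * complex_of_real (\<theta> j)) *s ket j) | \<theta>. \<forall>j. \<theta> j \<in> {0..<2 * pi}}"

definition decohering_power :: "(complex^'n^'n \<Rightarrow> complex^'n^'n) \<Rightarrow> real" where
  "decohering_power E =
     (GREATEST d. \<exists>\<Psi>\<in>max_coherent_states. d = C_l1 (pure_state \<Psi>) - C_l1 (E (pure_state \<Psi>)))"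

definition coherence_map :: "real \<Rightarrow> complex^'n^'n \<Rightarrow> complex^'n^'n" where
  "coherence_map \<alpha> \<rho> =
     (\<Sum>\<mu>\<in>UNIV. (\<rho> $ \<mu> $ \<mu>) *\<^sub>C ketbra (ket \<mu>) (ket \<mu>))
     + complex_of_real (1 + \<alpha>) *\<^sub>C
         (\<Sum>\<mu>\<in>UNIV. \<Sum>\<nu>\<in>UNIV - {\<mu>}. (\<rho> $ \<mu> $ \<nu>) *\<^sub>C ketbra (ket \<mu>) (ket \<nu>))"

definition network_depth ::
    "(complex^'n^'n \<Rightarrow> complex^'n^'n) \<Rightarrow> complex^'n \<Rightarrow> real \<Rightarrow> nat" where
  "network_depth E \<Psi> \<eta> = (LEAST r. C_l1 ((E ^^ r) (pure_state \<Psi>)) \<le> \<eta>)"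

end

theory Submission
  imports Defs
begin

text \<open>
  Every off-diagonal entry is multiplied by \<open>1 + \<alpha>\<close>, so \<open>C_l1\<close> contracts by \<open>\<bar>1 + \<alpha>\<bar>\<close> in each step.
  It equals \<open>N - 1\<close> on every maximally coherent state, hence
  \<open>N - 1 - D = \<bar>1 + \<alpha>\<bar> (N - 1)\<close>, the denominator of the bound is \<open>ln \<bar>1 + \<alpha>\<bar> < 0\<close>, and the bound is
  the logarithm of \<open>\<bar>1 + \<alpha>\<bar> ^ r (N - 1) \<le> \<eta>\<close>.
\<close>

lemma ket_component: "ket \<mu> $ i = (if i = \<mu> then 1 else 0)"
  by (simp add: ket_def axis_def)

lemma coherence_map_component:
  "coherence_map \<alpha> \<rho> $ i $ j =
     (if i = j then \<rho> $ i $ i else complex_of_real (1 + \<alpha>) * \<rho> $ i $ j)"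
proof -
  \<comment> \<open>The two index conditions are nested rather than conjoined, so that
    \<open>sum.delta\<close> can collapse one sum at a time.\<close>
  have [simp]: "(c *\<^sub>C ketbra (ket \<mu>) (ket \<nu>)) $ i $ j =
      (if \<mu> = i then if \<nu> = j then c else 0 else 0)" for c :: complex and \<mu> \<nu>
    by (simp add: matrix_scale_def ketbra_def ket_component)
  have diag: "(\<Sum>\<mu>\<in>UNIV. (\<rho> $ \<mu> $ \<mu>) *\<^sub>C ketbra (ket \<mu>) (ket \<mu>)) $ i $ j =
      (if i = j then \<rho> $ i $ i else 0)"
    by (simp add: sum_component sum.delta)
  \<comment> \<open>With the test on \<mu> outside the inner sum, the outer sum collapses to \<mu> =
    i; the inner one, over \<open>UNIV - {i}\<close>, then vanishes exactly when j = i is excluded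
    from its range.\<close>
  have "(\<Sum>\<mu>\<in>UNIV. \<Sum>\<nu>\<in>UNIV - {\<mu>}. (\<rho> $ \<mu> $ \<nu>) *\<^sub>C ketbra (ket \<mu>) (ket \<nu>)) $ i $ j =
      (\<Sum>\<mu>\<in>UNIV. if \<mu> = i then \<Sum>\<nu>\<in>UNIV - {\<mu>}. if \<nu> = j then \<rho> $ \<mu> $ \<nu> else 0 else 0)"
    unfolding sum_component by (intro sum.cong refl) simp
  also have "\<dots> = (if i = j then 0 else \<rho> $ i $ j)"
    by (simp add: sum.delta)
  finally show ?thesis
    using diag by (simp add: coherence_map_def matrix_scale_def)
qed

lemma C_l1_coherence_map: "C_l1 (coherence_map \<alpha> \<rho>) = \<bar>1 + \<alpha>\<bar> * C_l1 \<rho>"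
proof -
  have "C_l1 (coherence_map \<alpha> \<rho>) =
      (\<Sum>\<mu>\<in>UNIV. \<Sum>\<nu>\<in>UNIV - {\<mu>}. \<bar>1 + \<alpha>\<bar> * norm (\<rho> $ \<mu> $ \<nu>))"
    unfolding C_l1_def
    \<comment> \<open>Keeping \<open>complex_of_real (1 + \<alpha>)\<close> unsplit lets its norm
      simplify to \<bar>1 + \<alpha>\<bar>.\<close>
    by (intro sum.cong refl) (auto simp: coherence_map_component norm_mult simp del: of_real_add)
  then show ?thesis
    by (simp add: C_l1_def sum_distrib_left)
qed

lemma C_l1_coherence_map_funpow:
  "C_l1 ((coherence_map \<alpha> ^^ k) \<rho>) = \<bar>1 + \<alpha>\<bar> ^ k * C_l1 \<rho>"
  by (induction k) (simp_all add: C_l1_coherence_map)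

lemma norm_max_coherent_component:
  fixes \<Psi> :: "complex^'n"
  assumes "\<Psi> \<in> max_coherent_states"
  shows "norm (\<Psi> $ i) = 1 / sqrt (real CARD('n))"
proof -
  obtain \<theta> where \<Psi>: "\<Psi> = complex_of_real (1 / sqrt (real CARD('n))) *s
      (\<Sum>j\<in>UNIV. exp (\<i> * complex_of_real (\<theta> j)) *s ket j)"
    using assms unfolding max_coherent_states_def by blast
  have "(\<Sum>j\<in>UNIV. exp (\<i> * complex_of_real (\<theta> j)) *s ket j) $ i = exp (\<i> * complex_of_real (\<theta> i))"
    by (simp add: sum_component ket_component if_distrib cong: if_cong)
  then show ?thesis
    by (simp add: \<Psi> norm_mult norm_divide)
qed

text \<open>The phases have modulus one, so every entry has modulus 1/N, and there are N (N - 1)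
  off-diagonal entries.\<close>

lemma C_l1_max_coherent:
  fixes \<Psi> :: "complex^'n"
  assumes "\<Psi> \<in> max_coherent_states"
  shows "C_l1 (pure_state \<Psi>) = real CARD('n) - 1"
proof -
  have "norm (pure_state \<Psi> $ \<mu> $ \<nu>) = 1 / real CARD('n)" for \<mu> \<nu>
    by (simp add: ketbra_def norm_mult norm_max_coherent_component[OF assms])
  then have "C_l1 (pure_state \<Psi>) = real CARD('n) * (real (CARD('n) - 1) / real CARD('n))"
    by (simp add: C_l1_def card_Diff_subset)
  then show ?thesis
    by (simp add: of_nat_diff)
qed

text \<open>The coherence loss is the same for all maximally coherent states, so
  \<open>GREATEST\<close> ranges over a single value, attained because such a state exists.\<close>

lemma decohering_power_coherence_map:
  assumes "(max_coherent_states :: (complex^'n) set) \<noteq> {}"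
  shows "decohering_power (coherence_map \<alpha> :: complex^'n^'n \<Rightarrow> complex^'n^'n) =
    (1 - \<bar>1 + \<alpha>\<bar>) * (real CARD('n) - 1)"
proof -
  have "C_l1 (pure_state \<Psi>) - C_l1 (coherence_map \<alpha> (pure_state \<Psi>)) =
      (1 - \<bar>1 + \<alpha>\<bar>) * (real CARD('n) - 1)"
    if "\<Psi> \<in> max_coherent_states" for \<Psi> :: "complex^'n"
    by (simp add: C_l1_coherence_map C_l1_max_coherent[OF that] algebra_simps)
  then show ?thesis
    unfolding decohering_power_def using assms by (intro Greatest_equality) auto
qed

theorem proposition5:
  fixes \<alpha> \<eta> :: real and \<Psi> :: "complex^'n" and r :: nat
  assumes "CARD('n) \<ge> 2"
    and "0 < \<bar>1 + \<alpha>\<bar>" and "\<bar>1 + \<alpha>\<bar> < 1"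
    and "completely_positive (coherence_map \<alpha> :: complex^'n^'n \<Rightarrow> complex^'n^'n)"
    and "trace_preserving (coherence_map \<alpha> :: complex^'n^'n \<Rightarrow> complex^'n^'n)"
    and "0 < \<eta>" and "\<eta> < 1"
    and "\<Psi> \<in> max_coherent_states"
    and "r = network_depth (coherence_map \<alpha>) \<Psi> \<eta>"
  shows "int r \<ge>
    \<lceil>(ln \<eta> - ln (real CARD('n) - 1)) /
      (ln (real CARD('n) - 1
           - decohering_power (coherence_map \<alpha> :: complex^'n^'n \<Rightarrow> complex^'n^'n))
       - ln (real CARD('n) - 1))\<rceil>"
proof -
  let ?q = "\<bar>1 + \<alpha>\<bar>" and ?M = "real CARD('n) - 1"
  have M: "?M > 0"
    using assms(1) by simp
  have C: "C_l1 ((coherence_map \<alpha> ^^ k) (pure_state \<Psi>)) = ?q ^ k * ?M" for k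
    by (simp add: C_l1_coherence_map_funpow C_l1_max_coherent[OF assms(8)])
  \<comment> \<open>Some depth reaches precision \<eta>, so the \<open>LEAST\<close> defining r is
    attained and r itself satisfies the bound.\<close>
  obtain k where "?q ^ k < \<eta> / ?M"
    using real_arch_pow_inv[of "\<eta> / ?M" ?q] assms(3,6) M by auto
  then have "C_l1 ((coherence_map \<alpha> ^^ k) (pure_state \<Psi>)) \<le> \<eta>"
    using M by (simp add: C field_simps)
  then have "C_l1 ((coherence_map \<alpha> ^^ r) (pure_state \<Psi>)) \<le> \<eta>"
    unfolding assms(9) network_depth_def by (rule LeastI)
  then have "ln (?q ^ r * ?M) \<le> ln \<eta>"
    using assms(2,6) M by (subst ln_le_cancel_iff) (auto simp: C)
  moreover have "ln (?q ^ r * ?M) = real r * ln ?q + ln ?M"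
    using assms(2) M by (simp add: ln_mult ln_realpow)
  moreover have neg: "ln ?q < 0"
    using assms(2,3) by simp
  \<comment> \<open>Dividing by the negative \<open>ln ?q\<close> reverses the inequality, turning
    it into a lower bound on r.\<close>
  ultimately have bound: "(ln \<eta> - ln ?M) / ln ?q \<le> real r"
    by (simp add: neg_divide_le_eq)
  have "decohering_power (coherence_map \<alpha> :: complex^'n^'n \<Rightarrow> complex^'n^'n) = (1 - ?q) * ?M"
    using assms(8) by (intro decohering_power_coherence_map) auto
  then have "?M - decohering_power (coherence_map \<alpha> :: complex^'n^'n \<Rightarrow> complex^'n^'n) = ?q * ?M"
    by (simp add: algebra_simps)
  moreover have "ln (?q * ?M) - ln ?M = ln ?q"
    using assms(2) M by (simp add: ln_mult)
  ultimately show ?thesis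
    \<comment> \<open>Since r is an integer, the real bound passes to the ceiling.\<close>
    using bound by (simp add: ceiling_le_iff)
qed

end
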